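(* Let $G$ be a graph on $n$ vertices and let $X\in M_n(\mathbb{R})$ be a real matrix. Then $$\|X+\mathcal{S}_G^{\perp}\|_{\mathrm{osp}}=\max\{\operatorname{Tr}(X^TQ):Q\in\mathcal{S}_G\cap M_n(\mathbb{R}),\ \operatorname{Tr}(|Q|)\le 1\}.$$
   Context: $M_n$ denotes the complex $n\times n$ matrices with the operator norm $\|\cdot\|$ and matrix units $E_{i,j}$; $M_n(\mathbb{R})$ the real matrices; $X^T$ the transpose; $|Q|=(Q^*Q)^{1/2}$. A graph $G$ on $n$ vertices is a symmetric subset $G\subseteq\{1,\dots,n\}^2$ containing no $(i,i)$; $\widetilde G=G\cup\{(i,i):1\le i\le n\}$; $\mathcal{S}_G=\operatorname{span}\{E_{i,j}:(i,j)\in\widetilde G\}\subseteq M_n$, and $\mathcal{S}_G^\perp=\operatorname{span}\{E_{i,j}:(i,j)\notin\widetilde G\}$ is its orthogonal complement for the inner product $\operatorname{tr}(ab^* )$. The operator space quotient norm is $\|X+\mathcal{S}_G^\perp\|_{\mathrm{osp}}=\inf\{\|X+K\|:K\in\mathcal{S}_G^\perp\}$. *)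

theory Defs
  imports "HOL-Analysis.Analysis"
begin

text \<open>
  \<open>M\<^sub>n\<close> is the type \<open>complex ^ 'n ^ 'n\<close> and \<open>M\<^sub>n(\<real>)\<close> is \<open>real ^ 'n ^ 'n\<close>, with \<open>n = CARD('n)\<close> and
  the finite type \<open>'n\<close> as the vertex set; a graph is a symmetric irreflexive relation on it.
\<close>

abbreviation complex_matrix :: "real ^ 'n ^ 'm \<Rightarrow> complex ^ 'n ^ 'm" where
  "complex_matrix \<equiv> map_matrix complex_of_real"

abbreviation opnorm :: "complex ^ 'n ^ 'm \<Rightarrow> real" where
  "opnorm A \<equiv> onorm (\<lambda>v. A *v v)"

definition conj_transpose :: "complex ^ 'n ^ 'm \<Rightarrow> complex ^ 'm ^ 'n" where
  "conj_transpose A = transpose (map_matrix cnj A)"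

text \<open>
  The inner product \<open>\<bullet>\<close> on \<open>complex ^ 'n\<close> is the real part of the Hermitian one. For Hermitian
  \<open>A\<close> the number \<open>\<langle>A v, v\<rangle>\<close> is real, so the condition below is the usual one.
\<close>
definition pos_semidef :: "complex ^ 'n ^ 'n \<Rightarrow> bool" where
  "pos_semidef A \<longleftrightarrow> conj_transpose A = A \<and> (\<forall>v. 0 \<le> (A *v v) \<bullet> v)"

text \<open>The description is proper for positive semidefinite \<open>A\<close>, the only case in which it is used.\<close>
definition matrix_sqrt :: "complex ^ 'n ^ 'n \<Rightarrow> complex ^ 'n ^ 'n" where
  "matrix_sqrt A = (THE B. pos_semidef B \<and> B ** B = A)"

definition matrix_abs :: "complex ^ 'n ^ 'n \<Rightarrow> complex ^ 'n ^ 'n" where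
  "matrix_abs Q = matrix_sqrt (conj_transpose Q ** Q)"

definition matrix_unit :: "'n \<Rightarrow> 'n \<Rightarrow> complex ^ 'n ^ 'n" where
  "matrix_unit i j = (\<chi> k l. if k = i \<and> l = j then 1 else 0)"

text \<open>The unqualified \<open>span\<close> of the library is the real linear span.\<close>
abbreviation complex_span :: "(complex ^ 'n ^ 'm) set \<Rightarrow> (complex ^ 'n ^ 'm) set" where
  "complex_span \<equiv> module.span (\<lambda>(c::complex) A. map_matrix ((*) c) A)"

lemma vector_space_complex_matrix:
  "vector_space (\<lambda>(c::complex) (A :: complex ^ 'n ^ 'm). map_matrix ((*) c) A)"
  by unfold_locales (simp_all add: vec_eq_iff algebra_simps)

definition graph_space :: "('n \<times> 'n) set \<Rightarrow> (complex ^ 'n ^ 'n) set" where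
  "graph_space G = complex_span {matrix_unit i j | i j. (i, j) \<in> G \<union> Id}"

definition graph_space_perp :: "('n \<times> 'n) set \<Rightarrow> (complex ^ 'n ^ 'n) set" where
  "graph_space_perp G = complex_span {matrix_unit i j | i j. (i, j) \<notin> G \<union> Id}"

definition osp_norm :: "('n \<times> 'n) set \<Rightarrow> complex ^ 'n ^ 'n \<Rightarrow> real" where
  "osp_norm G X = (INF K \<in> graph_space_perp G. opnorm (X + K))"

end

theory Submission
  imports Defs
begin

text \<open>
  The identity is the duality between the operator norm on \<open>M\<^sub>n(\<real>)\<close> and the trace norm, passed to
  a quotient. On real matrices \<open>Tr(X\<^sup>T Q)\<close> is the Euclidean inner product \<open>X \<bullet> Q\<close>.

  The trace norm is computed in a real orthonormal eigenbasis \<open>B\<close> of \<open>Q\<^sup>T Q\<close>. The uniqueness of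
  positive square roots forces \<open>|Q| b = \<parallel>Q b\<parallel> b\<close> for \<open>b \<in> B\<close>, so that
  \<open>Tr |Q| = \<Sum>\<^sub>b \<parallel>Q b\<parallel>\<close> (\<open>trace_matrix_abs_eq_sum\<close>), while \<open>A \<bullet> Q = \<Sum>\<^sub>b \<langle>A b, Q b\<rangle>\<close> by Parseval.
  Hence \<open>A \<bullet> Q \<le> \<parallel>A\<parallel> Tr |Q|\<close>, and the partial isometry of the polar decomposition of \<open>Q\<close> gives
  equality (\<open>trace_norm_attained\<close>): the trace norm is the dual norm.

  If \<open>Q \<in> \<S>\<^sub>G\<close> and \<open>Tr |Q| \<le> 1\<close>, then \<open>X \<bullet> Q = Re (X + K) \<bullet> Q \<le> \<parallel>X + K\<parallel>\<close> for every complex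
  \<open>K \<in> \<S>\<^sub>G\<^sup>\<bottom>\<close>, because \<open>K\<close> and \<open>Q\<close> have disjoint supports. So no value exceeds the quotient norm \<open>r\<close>
  (\<open>trace_norm_ball_le_osp_norm\<close>).

  Conversely, when \<open>r > 0\<close> the convex set of real matrices of norm less than \<open>r\<close> misses the affine
  space of the \<open>X + K\<close> with \<open>K \<in> \<S>\<^sub>G\<^sup>\<bottom>\<close> real. A separating functional is constant on that affine space,
  hence is given by a matrix in \<open>\<S>\<^sub>G\<close>; suitably scaled it has dual norm at most \<open>1\<close>
  and takes the value \<open>r\<close> at \<open>X\<close> (\<open>osp_norm_attained_on_trace_norm_ball\<close>). This matrix is real because
  the separation takes place in the real space \<open>M\<^sub>n(\<real>)\<close>.
\<close>

section \<open>The real spectral theorem\<close>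

text \<open>
  Spanning is expressed by the expansion formula, the only form in which it is used; it also passes
  directly to the induction on the dimension of \<open>S\<close>.
\<close>
definition orthonormal_basis_of :: "'a::euclidean_space set \<Rightarrow> 'a set \<Rightarrow> bool" where
  "orthonormal_basis_of S B \<longleftrightarrow> finite B \<and> B \<subseteq> S \<and>
     (\<forall>b\<in>B. \<forall>c\<in>B. b \<bullet> c = (if b = c then 1 else 0)) \<and>
     (\<forall>x\<in>S. x = (\<Sum>b\<in>B. (x \<bullet> b) *\<^sub>R b))"

lemma orthonormal_basis_ofD:
  assumes "orthonormal_basis_of S B"
  shows "finite B" and "b \<in> B \<Longrightarrow> b \<in> S"
    and "b \<in> B \<Longrightarrow> c \<in> B \<Longrightarrow> b \<bullet> c = (if b = c then 1 else 0)"
    and "x \<in> S \<Longrightarrow> x = (\<Sum>b\<in>B. (x \<bullet> b) *\<^sub>R b)"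
  using assms unfolding orthonormal_basis_of_def by blast+

lemma nonneg_quadratic_linear_term_zero:
  fixes h g :: real
  assumes "\<And>t. 0 \<le> 2 * t * h + t\<^sup>2 * g"
  shows "h = 0"
proof (rule ccontr)
  assume "h \<noteq> 0"
  (* At t = - h / k the linear term dominates as soon as k exceeds g / 2. *)
  define k where "k = \<bar>g\<bar> + 1"
  have k: "k > 0" "g < k" by (auto simp: k_def)
  have "0 \<le> 2 * (- h / k) * h + (- h / k)\<^sup>2 * g" by (rule assms)
  also have "\<dots> = (h\<^sup>2 / k\<^sup>2) * (g - 2 * k)"
    using k by (simp add: field_simps power2_eq_square)
  also have "\<dots> < 0"
    using k \<open>h \<noteq> 0\<close> by (intro mult_pos_neg) auto
  finally show False by simp
qed

text \<open>
  A maximizer \<open>v\<close> of the Rayleigh quotient on the unit sphere of \<open>S\<close> is an eigenvector: with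
  \<open>l = \<langle>f v, v\<rangle>\<close> the form \<open>l \<langle>x, x\<rangle> - \<langle>f x, x\<rangle>\<close> is nonnegative on \<open>S\<close> and vanishes at \<open>v\<close>, so
  its derivative at \<open>v\<close> vanishes in every direction of \<open>S\<close>, in particular along \<open>l v - f v\<close>.
\<close>
lemma selfadjoint_eigenvector_exists:
  fixes f :: "'a::euclidean_space \<Rightarrow> 'a"
  assumes lin: "linear f" and sa: "\<And>x y. f x \<bullet> y = x \<bullet> f y"
    and S: "subspace S" and inv: "\<And>x. x \<in> S \<Longrightarrow> f x \<in> S" and ne: "S \<noteq> {0}"
  obtains v where "v \<in> S" "norm v = 1" "f v = (f v \<bullet> v) *\<^sub>R v"
proof -
  let ?K = "S \<inter> sphere 0 1"
  have "compact ?K"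
    using closed_subspace[OF S] by (simp add: closed_Int_compact)
  moreover have "?K \<noteq> {}"
  proof -
    obtain x where "x \<in> S" "x \<noteq> 0" using ne subspace_0[OF S] by blast
    then have "x /\<^sub>R norm x \<in> ?K" using S by (simp add: subspace_scale)
    then show ?thesis by blast
  qed
  moreover have "continuous_on ?K (\<lambda>x. f x \<bullet> x)"
    using lin by (intro continuous_intros linear_continuous_on)
      (simp add: linear_conv_bounded_linear)
  ultimately obtain v where vK: "v \<in> ?K" "\<forall>x\<in>?K. f x \<bullet> x \<le> f v \<bullet> v"
    using continuous_attains_sup[of ?K "\<lambda>x. f x \<bullet> x"] by blast
  then have v: "v \<in> S" "norm v = 1"
    and vmax: "\<And>x. x \<in> S \<Longrightarrow> norm x = 1 \<Longrightarrow> f x \<bullet> x \<le> f v \<bullet> v"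
    by auto
  define l where "l = f v \<bullet> v"
  have lv: "v \<bullet> f v = l" by (simp add: l_def inner_commute)
  note fs = linear_add[OF lin] linear_scale[OF lin]
  have g: "0 \<le> l * (x \<bullet> x) - f x \<bullet> x" if "x \<in> S" for x
  proof (cases "x = 0")
    case False
    have "f (x /\<^sub>R norm x) \<bullet> (x /\<^sub>R norm x) \<le> l"
      unfolding l_def using False that S by (intro vmax) (auto simp: subspace_scale)
    then show ?thesis
      using False by (simp add: fs dot_square_norm field_simps power2_eq_square)
  qed (simp add: linear_0[OF lin])
  have vv: "v \<bullet> v = 1" using v by (simp add: dot_square_norm)
  have stat: "l * (v \<bullet> w) - f v \<bullet> w = 0" if w: "w \<in> S" for w
  proof (rule nonneg_quadratic_linear_term_zero)
    fix t :: real
    have "v + t *\<^sub>R w \<in> S" using v w S by (simp add: subspace_add subspace_scale)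
    from g[OF this] show "0 \<le> 2 * t * (l * (v \<bullet> w) - f v \<bullet> w) + t\<^sup>2 * (l * (w \<bullet> w) - f w \<bullet> w)"
      using sa[of w v] vv lv
      by (simp add: fs inner_simps l_def[symmetric] inner_commute algebra_simps power2_eq_square)
  qed
  define w where "w = l *\<^sub>R v - f v"
  have "w \<in> S" using v S inv by (simp add: w_def subspace_diff subspace_scale)
  from stat[OF this] have "w \<bullet> w = 0"
    unfolding w_def by (simp add: inner_simps algebra_simps)
  then have "f v = (f v \<bullet> v) *\<^sub>R v" by (simp add: w_def l_def)
  with v show thesis using that by blast
qed

text \<open>
  The spectral theorem, for a map given on the whole space and an invariant subspace, so that the
  induction can pass to the orthogonal complement of an eigenvector within \<open>S\<close>.
\<close>
lemma selfadjoint_orthonormal_eigenbasis_of: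
  fixes f :: "'a::euclidean_space \<Rightarrow> 'a"
  assumes lin: "linear f" and sa: "\<And>x y. f x \<bullet> y = x \<bullet> f y"
    and "subspace S" and "\<And>x. x \<in> S \<Longrightarrow> f x \<in> S"
  shows "\<exists>B. orthonormal_basis_of S B \<and> (\<forall>b\<in>B. f b = (f b \<bullet> b) *\<^sub>R b)"
  using assms(3,4)
proof (induction "dim S" arbitrary: S rule: less_induct)
  case less
  show ?case
  proof (cases "S = {0}")
    case True
    then show ?thesis by (intro exI[of _ "{}"]) (auto simp: orthonormal_basis_of_def)
  next
    case False
    obtain v where v: "v \<in> S" "norm v = 1" "f v = (f v \<bullet> v) *\<^sub>R v"
      using selfadjoint_eigenvector_exists[OF lin sa less.prems False] by blast
    have vv: "v \<bullet> v = 1" using v by (simp add: dot_square_norm)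
    define S' where "S' = {x \<in> S. x \<bullet> v = 0}"
    have sub: "subspace S'"
      using less.prems(1) by (auto simp: S'_def subspace_def inner_simps)
    have "v \<notin> S'" "S' \<subseteq> S" using vv by (auto simp: S'_def)
    then have "S' \<subset> S" using v by blast
    then have "dim S' < dim S"
      using sub less.prems(1) by (metis dim_psubset span_eq_iff)
    moreover have "f x \<in> S'" if "x \<in> S'" for x
    proof -
      have "f x \<bullet> v = x \<bullet> ((f v \<bullet> v) *\<^sub>R v)" by (subst v(3)[symmetric]) (rule sa)
      then show ?thesis using that less.prems(2) by (simp add: S'_def)
    qed
    ultimately obtain B where B: "orthonormal_basis_of S' B"
      and eig: "\<forall>b\<in>B. f b = (f b \<bullet> b) *\<^sub>R b"
      using less.hyps[OF _ sub] by blast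
    have bv: "b \<bullet> v = 0" "v \<bullet> b = 0" "b \<in> S" if "b \<in> B" for b
      using orthonormal_basis_ofD(2)[OF B that] by (auto simp: S'_def inner_commute)
    have vB: "v \<notin> B" using bv vv by fastforce
    have expand: "x = (\<Sum>b\<in>insert v B. (x \<bullet> b) *\<^sub>R b)" if x: "x \<in> S" for x
    proof -
      let ?y = "x - (x \<bullet> v) *\<^sub>R v"
      have "?y \<in> S'"
        using x v vv less.prems(1) by (simp add: S'_def subspace_diff subspace_scale inner_simps)
      then have "?y = (\<Sum>b\<in>B. (?y \<bullet> b) *\<^sub>R b)"
        by (rule orthonormal_basis_ofD(4)[OF B])
      also have "\<dots> = (\<Sum>b\<in>B. (x \<bullet> b) *\<^sub>R b)"
        using bv by (intro sum.cong) (auto simp: inner_simps)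
      finally show ?thesis
        using orthonormal_basis_ofD(1)[OF B] vB by (simp add: algebra_simps)
    qed
    have "orthonormal_basis_of S (insert v B)"
      unfolding orthonormal_basis_of_def
    proof (intro conjI ballI)
      show "finite (insert v B)" using orthonormal_basis_ofD(1)[OF B] by simp
      show "insert v B \<subseteq> S" using bv v by auto
      show "b \<bullet> c = (if b = c then 1 else 0)" if "b \<in> insert v B" "c \<in> insert v B" for b c
        using that vB vv bv by (auto simp: orthonormal_basis_ofD(3)[OF B])
      show "x = (\<Sum>b\<in>insert v B. (x \<bullet> b) *\<^sub>R b)" if "x \<in> S" for x
        by (rule expand[OF that])
    qed
    then show ?thesis using eig v(3) by blast
  qed
qed

lemma orthonormal_basis_parseval:
  assumes "orthonormal_basis_of UNIV B"
  shows "x \<bullet> y = (\<Sum>b\<in>B. (x \<bullet> b) * (y \<bullet> b))"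
proof -
  have "y = (\<Sum>b\<in>B. (y \<bullet> b) *\<^sub>R b)" by (rule orthonormal_basis_ofD(4)[OF assms UNIV_I])
  then have "x \<bullet> y = x \<bullet> (\<Sum>b\<in>B. (y \<bullet> b) *\<^sub>R b)" by simp
  then show ?thesis by (simp add: inner_sum_right mult.commute)
qed

lemma matrix_inner_eq_sum_basis:
  fixes A C :: "real ^ 'n ^ 'm"
  assumes "orthonormal_basis_of UNIV B"
  shows "A \<bullet> C = (\<Sum>b\<in>B. (A *v b) \<bullet> (C *v b))"
proof -
  have "A \<bullet> C = (\<Sum>i\<in>UNIV. \<Sum>b\<in>B. (A $ i \<bullet> b) * (C $ i \<bullet> b))"
    unfolding inner_vec_def[of A C] by (intro sum.cong refl orthonormal_basis_parseval[OF assms])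
  also have "\<dots> = (\<Sum>b\<in>B. \<Sum>i\<in>UNIV. (A $ i \<bullet> b) * (C $ i \<bullet> b))"
    by (rule sum.swap)
  finally show ?thesis
    by (simp add: inner_vec_def[of "A *v _"] matrix_vector_mul_component)
qed

lemma inner_transpose_mult:
  fixes A :: "real ^ 'n ^ 'm"
  shows "(A *v x) \<bullet> y = x \<bullet> (transpose A *v y)"
  by (simp add: dot_lmul_matrix[symmetric] inner_commute)

text \<open>The right singular vectors of \<open>Q\<close>; the singular value belonging to \<open>b\<close> is \<open>\<parallel>Q b\<parallel>\<close>.\<close>
lemma singular_basis_exists:
  fixes Q :: "real ^ 'n ^ 'n"
  obtains B where "orthonormal_basis_of UNIV B"
    "\<And>b. b \<in> B \<Longrightarrow> (transpose Q ** Q) *v b = (norm (Q *v b))\<^sup>2 *\<^sub>R b"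
proof -
  let ?f = "\<lambda>x. (transpose Q ** Q) *v x"
  have f: "?f x \<bullet> y = (Q *v x) \<bullet> (Q *v y)" for x y
    using inner_transpose_mult[of Q y "Q *v x"]
    by (simp only: matrix_vector_mul_assoc[symmetric] inner_commute)
  have sa: "?f x \<bullet> y = x \<bullet> ?f y" for x y
    using f[of x y] f[of y x] by (simp only: inner_commute)
  obtain B where B: "orthonormal_basis_of UNIV B" "\<forall>b\<in>B. ?f b = (?f b \<bullet> b) *\<^sub>R b"
    using selfadjoint_orthonormal_eigenbasis_of[OF matrix_vector_mul_linear sa subspace_UNIV UNIV_I]
    by blast
  show thesis
    using B unfolding f dot_square_norm by (intro that) auto
qed

section \<open>Complexification\<close>

abbreviation complex_vector :: "real ^ 'n \<Rightarrow> complex ^ 'n" where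
  "complex_vector x \<equiv> \<chi> i. complex_of_real (x $ i)"

lemma complex_matrix_mult_vector:
  "complex_matrix A *v complex_vector x = complex_vector (A *v x)"
  by (simp add: vec_eq_iff matrix_vector_mult_def)

lemma complex_vector_inner: "complex_vector x \<bullet> complex_vector y = x \<bullet> y"
  by (simp add: inner_vec_def inner_complex_def)

lemma norm_complex_vector: "norm (complex_vector x) = norm x"
  by (simp add: norm_eq_sqrt_inner complex_vector_inner)

lemma complex_matrix_inner_Re_Im:
  fixes z w :: "complex ^ 'n"
  shows "(complex_matrix A *v z) \<bullet> w =
    (A *v (\<chi> i. Re (z $ i))) \<bullet> (\<chi> i. Re (w $ i)) + (A *v (\<chi> i. Im (z $ i))) \<bullet> (\<chi> i. Im (w $ i))"
  by (simp add: inner_vec_def matrix_vector_mult_def inner_complex_def sum.distrib)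

text \<open>A real matrix acts separately on the real and imaginary parts of a complex vector.\<close>
lemma opnorm_complex_matrix_le_1:
  fixes A :: "real ^ 'n ^ 'm"
  assumes "\<And>x. norm (A *v x) \<le> norm x"
  shows "opnorm (complex_matrix A) \<le> 1"
proof (rule onorm_le)
  fix z :: "complex ^ 'n"
  let ?x = "\<chi> i. Re (z $ i)" and ?y = "\<chi> i. Im (z $ i)"
  have "(norm (complex_matrix A *v z))\<^sup>2 = (norm (A *v ?x))\<^sup>2 + (norm (A *v ?y))\<^sup>2"
    unfolding power2_norm_eq_inner
    by (simp add: inner_vec_def matrix_vector_mult_def inner_complex_def sum.distrib)
  also have "\<dots> \<le> (norm ?x)\<^sup>2 + (norm ?y)\<^sup>2"
    by (intro add_mono power_mono assms) auto
  also have "\<dots> = (norm z)\<^sup>2"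
    unfolding power2_norm_eq_inner
    by (simp add: inner_vec_def inner_complex_def sum.distrib)
  finally show "norm (complex_matrix A *v z) \<le> 1 * norm z"
    using power2_le_imp_le[OF _ norm_ge_zero] by simp
qed

section \<open>The trace norm\<close>

lemma inner_conj_transpose:
  "(A *v x) \<bullet> y = x \<bullet> (conj_transpose A *v y)"
proof -
  have adj: "(a * p) \<bullet> q = p \<bullet> (cnj a * q)" for a p q :: complex
    by (simp add: inner_complex_def algebra_simps)
  have "(A *v x) \<bullet> y = (\<Sum>i\<in>UNIV. \<Sum>j\<in>UNIV. (A $ i $ j * x $ j) \<bullet> (y $ i))"
    by (simp add: inner_vec_def matrix_vector_mult_def inner_sum_left)
  also have "\<dots> = (\<Sum>j\<in>UNIV. \<Sum>i\<in>UNIV. (A $ i $ j * x $ j) \<bullet> (y $ i))"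
    by (rule sum.swap)
  also have "\<dots> = x \<bullet> (conj_transpose A *v y)"
    by (simp add: inner_vec_def matrix_vector_mult_def inner_sum_right conj_transpose_def
        transpose_def adj)
  finally show ?thesis .
qed

text \<open>
  This is what makes the positive square root unique. If \<open>s > 0\<close>, then \<open>(C + s)(C - s) v = 0\<close>
  makes \<open>w = (C - s) v\<close> an eigenvector for \<open>- s\<close> unless it is zero, against \<open>\<langle>C w, w\<rangle> \<ge> 0\<close>. If \<open>s = 0\<close>, then
  \<open>\<parallel>C v\<parallel>\<^sup>2 = \<langle>v, C\<^sup>2 v\<rangle> = 0\<close>.
\<close>
lemma pos_semidef_sqrt_eigenvector:
  assumes "pos_semidef C" and sq: "(C ** C) *v v = (s\<^sup>2) *\<^sub>R v" and "0 \<le> s"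
  shows "C *v v = s *\<^sub>R v"
proof -
  have herm: "(C *v x) \<bullet> y = x \<bullet> (C *v y)" for x y
    using inner_conj_transpose[of C] assms(1) by (simp add: pos_semidef_def)
  have CC: "C *v (C *v v) = (s\<^sup>2) *\<^sub>R v"
    using sq by (simp add: matrix_vector_mul_assoc)
  show ?thesis
  proof (cases "s = 0")
    case True
    have "(C *v v) \<bullet> (C *v v) = 0" using herm[of v "C *v v"] CC True by simp
    then show ?thesis using True by simp
  next
    case False
    define w where "w = C *v v - s *\<^sub>R v"
    have "C *v w = (- s) *\<^sub>R w"
      unfolding w_def
      by (simp add: matrix_vector_mult_diff_distrib linear_scale[OF matrix_vector_mul_linear] CC
          algebra_simps power2_eq_square)
    moreover have "0 \<le> (C *v w) \<bullet> w" using assms(1) by (simp add: pos_semidef_def)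
    ultimately have "s * (w \<bullet> w) \<le> 0" by simp
    then have "w \<bullet> w \<le> 0" using False \<open>0 \<le> s\<close> by (simp add: mult_le_0_iff)
    then have "w = 0" by (metis inner_gt_zero_iff not_le)
    then show ?thesis by (simp add: w_def)
  qed
qed

lemma complex_vector_axis: "complex_vector (axis i 1) = axis i 1"
  by (simp add: vec_eq_iff axis_def)

lemma linear_complex_vector: "linear complex_vector"
  by (simp add: linear_iff vec_eq_iff complex_eq_iff)

text \<open>
  A real basis of \<open>\<real>\<^sup>n\<close> is a complex basis of \<open>\<complex>\<^sup>n\<close>, so the real spectral theorem suffices to
  identify complex square roots.
\<close>
lemma matrix_eqI_real_basis:
  fixes C D :: "complex ^ 'n ^ 'm"
  assumes B: "orthonormal_basis_of UNIV B"
    and eq: "\<And>b. b \<in> B \<Longrightarrow> C *v complex_vector b = D *v complex_vector b"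
  shows "C = D"
proof -
  have lin: "linear (\<lambda>x. A *v complex_vector x)" for A :: "complex ^ 'n ^ 'm"
    using linear_compose[OF linear_complex_vector matrix_vector_mul_linear, of A]
    by (simp add: o_def)
  have *: "C *v complex_vector x = D *v complex_vector x" for x
  proof -
    have x: "x = (\<Sum>b\<in>B. (x \<bullet> b) *\<^sub>R b)" by (rule orthonormal_basis_ofD(4)[OF B UNIV_I])
    have "A *v complex_vector x = (\<Sum>b\<in>B. (x \<bullet> b) *\<^sub>R (A *v complex_vector b))"
      for A :: "complex ^ 'n ^ 'm"
      by (subst x) (simp only: linear_sum[OF lin] linear_scale[OF lin])
    then show ?thesis using eq by simp
  qed
  have "A $ i $ j = (A *v axis j 1) $ i" for A :: "complex ^ 'n ^ 'm" and i j
    by (simp add: matrix_vector_mult_def axis_def if_distrib cong: if_cong)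
  then show ?thesis
    using *[of "axis _ 1"] unfolding complex_vector_axis by (simp add: vec_eq_iff)
qed

text \<open>
  \<open>M = \<Sum>\<^sub>b \<parallel>Q b\<parallel> b b\<^sup>T\<close> is a positive square root of \<open>Q\<^sup>T Q\<close>, and every other one agrees with it
  on the eigenvectors \<open>b\<close>. Its trace is the sum of the singular values since \<open>Tr(b b\<^sup>T) = 1\<close>.
\<close>
lemma trace_matrix_abs_eq_sum:
  fixes Q :: "real ^ 'n ^ 'n"
  assumes B: "orthonormal_basis_of UNIV B"
    and eig: "\<And>b. b \<in> B \<Longrightarrow> (transpose Q ** Q) *v b = (norm (Q *v b))\<^sup>2 *\<^sub>R b"
  shows "Re (trace (matrix_abs (complex_matrix Q))) = (\<Sum>b\<in>B. norm (Q *v b))"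
proof -
  define s where "s b = norm (Q *v b)" for b
  define M :: "real ^ 'n ^ 'n" where "M = (\<chi> i j. \<Sum>b\<in>B. s b * (b $ i * b $ j))"
  have orth: "b \<bullet> c = (if b = c then 1 else 0)" if "b \<in> B" "c \<in> B" for b c
    by (rule orthonormal_basis_ofD(3)[OF B that])
  have fin: "finite B" by (rule orthonormal_basis_ofD(1)[OF B])
  have Mx: "M *v x = (\<Sum>b\<in>B. (s b * (b \<bullet> x)) *\<^sub>R b)" for x
  proof -
    have "(M *v x) $ i = (\<Sum>b\<in>B. \<Sum>j\<in>UNIV. s b * (b $ i * b $ j) * x $ j)" for i
      unfolding M_def matrix_vector_mult_def
      by (simp add: sum_distrib_right) (rule sum.swap)
    then show ?thesis
      by (simp add: vec_eq_iff inner_vec_def sum_distrib_left sum_distrib_right algebra_simps)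
  qed
  have Mb: "M *v b = s b *\<^sub>R b" if "b \<in> B" for b
  proof -
    have "M *v b = (\<Sum>c\<in>B. if c = b then s b *\<^sub>R b else 0)"
      unfolding Mx by (intro sum.cong) (auto simp: orth that)
    then show ?thesis using fin that by simp
  qed
  have "(M *v x) \<bullet> x = (\<Sum>b\<in>B. s b * (b \<bullet> x)\<^sup>2)" for x
    unfolding Mx by (simp add: inner_sum_left power2_eq_square algebra_simps)
  then have Mpos: "0 \<le> (M *v x) \<bullet> x" for x
    by (simp add: s_def sum_nonneg)
  have "conj_transpose (complex_matrix M) = complex_matrix M"
    by (simp add: vec_eq_iff conj_transpose_def transpose_def M_def mult.commute)
  then have psd: "pos_semidef (complex_matrix M)"
    unfolding pos_semidef_def complex_matrix_inner_Re_Im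
    by (auto intro: add_nonneg_nonneg Mpos)
  have QQ: "conj_transpose (complex_matrix Q) ** complex_matrix Q = complex_matrix (transpose Q ** Q)"
    by (simp add: vec_eq_iff conj_transpose_def transpose_def matrix_matrix_mult_def)
  have sqM: "complex_matrix M ** complex_matrix M = complex_matrix (transpose Q ** Q)"
  proof (rule matrix_eqI_real_basis[OF B])
    fix b assume b: "b \<in> B"
    have "M *v (M *v b) = (transpose Q ** Q) *v b"
      by (simp only: Mb[OF b] eig[OF b] matrix_vector_mult_scaleR)
        (simp add: s_def power2_eq_square)
    then show "(complex_matrix M ** complex_matrix M) *v complex_vector b
        = complex_matrix (transpose Q ** Q) *v complex_vector b"
      by (simp only: matrix_vector_mul_assoc[symmetric] complex_matrix_mult_vector)
  qed
  have "matrix_abs (complex_matrix Q) = complex_matrix M"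
    unfolding matrix_abs_def matrix_sqrt_def QQ
  proof (rule the_equality)
    fix C assume C: "pos_semidef C \<and> C ** C = complex_matrix (transpose Q ** Q)"
    show "C = complex_matrix M"
    proof (rule matrix_eqI_real_basis[OF B])
      fix b assume b: "b \<in> B"
      have "(C ** C) *v complex_vector b = (s b)\<^sup>2 *\<^sub>R complex_vector b"
        using C by (simp only: complex_matrix_mult_vector eig[OF b] s_def
            linear_scale[OF linear_complex_vector])
      then have "C *v complex_vector b = s b *\<^sub>R complex_vector b"
        by (rule pos_semidef_sqrt_eigenvector[OF conjunct1[OF C]]) (simp add: s_def)
      then show "C *v complex_vector b = complex_matrix M *v complex_vector b"
        by (simp only: complex_matrix_mult_vector Mb[OF b] linear_scale[OF linear_complex_vector])
    qed
  qed (use psd sqM in blast)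
  then have "Re (trace (matrix_abs (complex_matrix Q))) = (\<Sum>i\<in>UNIV. \<Sum>b\<in>B. s b * (b $ i * b $ i))"
    by (simp add: trace_def M_def)
  also have "\<dots> = (\<Sum>b\<in>B. \<Sum>i\<in>UNIV. s b * (b $ i * b $ i))"
    by (rule sum.swap)
  also have "\<dots> = (\<Sum>b\<in>B. s b * (b \<bullet> b))"
    by (simp add: inner_vec_def sum_distrib_left)
  also have "\<dots> = (\<Sum>b\<in>B. s b)"
    by (intro sum.cong) (auto simp: orth)
  finally show ?thesis by (simp add: s_def)
qed

text \<open>
  \<open>W\<close> is the partial isometry in \<open>Q = W |Q|\<close>: it sends each right singular vector \<open>b\<close> with
  \<open>Q b \<noteq> 0\<close> to the left singular vector \<open>Q b / \<parallel>Q b\<parallel>\<close> and kills the others. These images are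
  orthogonal, so \<open>W\<close> is a contraction.
\<close>
lemma trace_norm_attained:
  fixes Q :: "real ^ 'n ^ 'n"
  obtains W :: "real ^ 'n ^ 'n" where "opnorm (complex_matrix W) \<le> 1"
    "W \<bullet> Q = Re (trace (matrix_abs (complex_matrix Q)))"
proof -
  obtain B where B: "orthonormal_basis_of UNIV B"
    and eig: "\<And>b. b \<in> B \<Longrightarrow> (transpose Q ** Q) *v b = (norm (Q *v b))\<^sup>2 *\<^sub>R b"
    using singular_basis_exists by blast
  have orth: "b \<bullet> c = (if b = c then 1 else 0)" if "b \<in> B" "c \<in> B" for b c
    by (rule orthonormal_basis_ofD(3)[OF B that])
  have fin: "finite B" by (rule orthonormal_basis_ofD(1)[OF B])
  (* If Q b = 0, division by zero makes u b = 0, as it should be. *)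
  define u where "u b = Q *v b /\<^sub>R norm (Q *v b)" for b
  define W :: "real ^ 'n ^ 'n" where "W = (\<chi> i j. \<Sum>b\<in>B. u b $ i * b $ j)"
  have Wx: "W *v x = (\<Sum>b\<in>B. (x \<bullet> b) *\<^sub>R u b)" for x
  proof -
    have "(W *v x) $ i = (\<Sum>b\<in>B. \<Sum>j\<in>UNIV. u b $ i * b $ j * x $ j)" for i
      unfolding W_def matrix_vector_mult_def
      by (simp add: sum_distrib_right) (rule sum.swap)
    then show ?thesis
      by (simp add: vec_eq_iff inner_vec_def sum_distrib_left sum_distrib_right algebra_simps)
  qed
  have Wb: "W *v b = u b" if "b \<in> B" for b
  proof -
    have "W *v b = (\<Sum>c\<in>B. if c = b then u b else 0)"
      unfolding Wx by (intro sum.cong) (auto simp: orth that)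
    then show ?thesis using fin that by simp
  qed
  have QbQc: "(Q *v b) \<bullet> (Q *v c) = 0" if "b \<in> B" "c \<in> B" "b \<noteq> c" for b c
  proof -
    have "(Q *v b) \<bullet> (Q *v c) = b \<bullet> ((transpose Q ** Q) *v c)"
      by (simp add: inner_transpose_mult matrix_vector_mul_assoc)
    then show ?thesis using that by (simp add: eig orth)
  qed
  have contr: "norm (W *v x) \<le> norm x" for x
  proof -
    have "(norm (W *v x))\<^sup>2 = (\<Sum>b\<in>B. (norm ((x \<bullet> b) *\<^sub>R u b))\<^sup>2)"
      unfolding Wx using fin
      by (intro norm_sum_Pythagorean) (auto simp: pairwise_def orthogonal_def u_def QbQc)
    also have "\<dots> \<le> (\<Sum>b\<in>B. (x \<bullet> b) * (x \<bullet> b))"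
    proof (rule sum_mono)
      fix b
      have "norm (u b) \<le> 1" by (cases "Q *v b = 0") (simp_all add: u_def)
      then have "(x \<bullet> b)\<^sup>2 * (norm (u b))\<^sup>2 \<le> (x \<bullet> b)\<^sup>2"
        by (intro mult_left_le power_le_one) auto
      moreover have "(norm ((x \<bullet> b) *\<^sub>R u b))\<^sup>2 = (x \<bullet> b)\<^sup>2 * (norm (u b))\<^sup>2"
        by (simp add: power_mult_distrib)
      ultimately show "(norm ((x \<bullet> b) *\<^sub>R u b))\<^sup>2 \<le> (x \<bullet> b) * (x \<bullet> b)"
        unfolding power2_eq_square[of "x \<bullet> b", symmetric] by linarith
    qed
    also have "\<dots> = (norm x)\<^sup>2"
      using orthonormal_basis_parseval[OF B, of x x] by (simp add: dot_square_norm)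
    finally show ?thesis using power2_le_imp_le[OF _ norm_ge_zero] by blast
  qed
  have "W \<bullet> Q = (\<Sum>b\<in>B. norm (Q *v b))"
    unfolding matrix_inner_eq_sum_basis[OF B]
  proof (intro sum.cong refl)
    fix b assume b: "b \<in> B"
    show "(W *v b) \<bullet> (Q *v b) = norm (Q *v b)"
      unfolding Wb[OF b] u_def
      by (cases "Q *v b = 0") (simp_all add: dot_square_norm power2_eq_square)
  qed
  then show thesis
    using that opnorm_complex_matrix_le_1[OF contr] trace_matrix_abs_eq_sum[OF B eig] by simp
qed

text \<open>
  Passing to the real part of \<open>A\<close> is free because \<open>A\<close> is only tested against real vectors:
  \<open>\<langle>Re A b, Q b\<rangle> = Re \<langle>A b, Q b\<rangle>\<close> as \<open>b\<close> and \<open>Q b\<close> are real.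
\<close>
lemma inner_Re_le_opnorm_trace_norm:
  fixes A :: "complex ^ 'n ^ 'n" and Q :: "real ^ 'n ^ 'n"
  shows "map_matrix Re A \<bullet> Q \<le> opnorm A * Re (trace (matrix_abs (complex_matrix Q)))"
proof -
  obtain B where B: "orthonormal_basis_of UNIV B"
    and eig: "\<And>b. b \<in> B \<Longrightarrow> (transpose Q ** Q) *v b = (norm (Q *v b))\<^sup>2 *\<^sub>R b"
    using singular_basis_exists by blast
  have "(map_matrix Re A *v b) \<bullet> (Q *v b) \<le> opnorm A * norm (Q *v b)" if "b \<in> B" for b
  proof -
    have "norm b = 1" using orthonormal_basis_ofD(3)[OF B that that] by (simp add: norm_eq_sqrt_inner)
    have "(map_matrix Re A *v b) \<bullet> (Q *v b) = (A *v complex_vector b) \<bullet> complex_vector (Q *v b)"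
      by (simp add: inner_vec_def inner_complex_def matrix_vector_mult_def)
    also have "\<dots> \<le> norm (A *v complex_vector b) * norm (complex_vector (Q *v b))"
      by (rule norm_cauchy_schwarz)
    also have "\<dots> \<le> (opnorm A * norm (complex_vector b)) * norm (complex_vector (Q *v b))"
      by (intro mult_right_mono onorm) auto
    finally show ?thesis by (simp add: norm_complex_vector \<open>norm b = 1\<close>)
  qed
  then show ?thesis
    using trace_matrix_abs_eq_sum[OF B eig]
    by (simp add: matrix_inner_eq_sum_basis[OF B] sum_distrib_left sum_mono)
qed

section \<open>Duality\<close>

lemma complex_span_matrix_units:
  "A \<in> complex_span {matrix_unit i j | i j. (i, j) \<in> S} \<longleftrightarrow> (\<forall>i j. (i, j) \<notin> S \<longrightarrow> A $ i $ j = 0)"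
    (is "?L \<longleftrightarrow> ?R")
proof -
  interpret cm: vector_space "\<lambda>(c::complex) (A :: complex ^ 'a ^ 'a). map_matrix ((*) c) A"
    by (rule vector_space_complex_matrix)
  let ?U = "{matrix_unit i j | i j. (i, j) \<in> S}"
  show ?thesis
  proof
    have "cm.span ?U \<subseteq> {A. \<forall>i j. (i, j) \<notin> S \<longrightarrow> A $ i $ j = 0}"
      by (rule cm.span_minimal) (auto simp: matrix_unit_def cm.subspace_def)
    then show "?L \<Longrightarrow> ?R" by blast
  next
    assume R: ?R
    have row: "(\<Sum>j\<in>UNIV. A $ i $ j * matrix_unit i j $ k $ l) = (if i = k then A $ k $ l else 0)"
      for i k l
      by (cases "i = k") (auto simp: matrix_unit_def if_distrib cong: if_cong)
    have "A = (\<Sum>i\<in>UNIV. \<Sum>j\<in>UNIV. map_matrix ((*) (A $ i $ j)) (matrix_unit i j))"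
      by (simp add: vec_eq_iff row)
    moreover have "map_matrix ((*) (A $ i $ j)) (matrix_unit i j) \<in> cm.span ?U" for i j
    proof (cases "(i, j) \<in> S")
      case True
      then show ?thesis by (intro cm.span_scale cm.span_base) blast
    next
      case False
      then have "map_matrix ((*) (A $ i $ j)) (matrix_unit i j) = 0"
        using R by (simp add: vec_eq_iff)
      then show ?thesis by (simp only: cm.span_zero)
    qed
    ultimately show ?L by (metis (no_types, lifting) cm.span_sum)
  qed
qed

lemma graph_space_iff:
  "A \<in> graph_space G \<longleftrightarrow> (\<forall>i j. (i, j) \<notin> G \<union> Id \<longrightarrow> A $ i $ j = 0)"
  unfolding graph_space_def by (rule complex_span_matrix_units)

lemma graph_space_perp_iff:
  "A \<in> graph_space_perp G \<longleftrightarrow> (\<forall>i j. (i, j) \<in> G \<union> Id \<longrightarrow> A $ i $ j = 0)"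
  unfolding graph_space_perp_def using complex_span_matrix_units[of A "- (G \<union> Id)"] by simp

lemma trace_transpose_mult_eq_inner:
  fixes A C :: "real ^ 'n ^ 'm"
  shows "trace (transpose A ** C) = A \<bullet> C"
  unfolding trace_def inner_vec_def matrix_matrix_mult_def transpose_def
  by simp (rule sum.swap)

lemma bdd_below_opnorm: "bdd_below ((\<lambda>K. opnorm (X + K)) ` S)"
  by (rule bdd_belowI[of _ 0]) (auto intro!: onorm_pos_le)

lemma trace_norm_ball_le_osp_norm:
  fixes X Q :: "real ^ 'n ^ 'n"
  assumes Q: "complex_matrix Q \<in> graph_space G"
    and t: "Re (trace (matrix_abs (complex_matrix Q))) \<le> 1"
  shows "X \<bullet> Q \<le> osp_norm G (complex_matrix X)"
  unfolding osp_norm_def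
proof (rule cINF_greatest)
  show "graph_space_perp G \<noteq> {}"
    using graph_space_perp_iff[of 0 G] by auto
next
  fix K assume K: "K \<in> graph_space_perp G"
  have zero: "map_matrix Re K $ i $ j * Q $ i $ j = 0" for i j
    using K Q unfolding graph_space_iff graph_space_perp_iff
    by (cases "(i, j) \<in> G \<union> Id") (auto simp del: Un_iff)
  have "map_matrix Re K \<bullet> Q = 0"
    unfolding inner_vec_def inner_real_def by (intro sum.neutral ballI zero)
  moreover have "map_matrix Re (complex_matrix X + K) = X + map_matrix Re K"
    by (simp add: vec_eq_iff)
  ultimately have "X \<bullet> Q = map_matrix Re (complex_matrix X + K) \<bullet> Q"
    by (simp add: inner_add_left)
  also have "\<dots> \<le> opnorm (complex_matrix X + K) * Re (trace (matrix_abs (complex_matrix Q)))"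
    by (rule inner_Re_le_opnorm_trace_norm)
  also have "\<dots> \<le> opnorm (complex_matrix X + K)"
    using t by (intro mult_left_le onorm_pos_le) auto
  finally show "X \<bullet> Q \<le> opnorm (complex_matrix X + K)" .
qed

lemma opnorm_convex_comb:
  assumes "0 \<le> u" "0 \<le> v"
  shows "opnorm (complex_matrix (u *\<^sub>R A + v *\<^sub>R C))
    \<le> u * opnorm (complex_matrix A) + v * opnorm (complex_matrix C)"
proof -
  have eq: "complex_matrix (u *\<^sub>R A + v *\<^sub>R C) *v z =
      u *\<^sub>R (complex_matrix A *v z) + v *\<^sub>R (complex_matrix C *v z)" for z
    by (simp add: vec_eq_iff matrix_vector_mult_def)
      (simp add: scaleR_conv_of_real sum.distrib sum_distrib_left algebra_simps)
  have bl: "bounded_linear (\<lambda>z. c *\<^sub>R (complex_matrix A *v z))" for c and A :: "real^'a^'b"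
    by (intro bounded_linear_compose[OF bounded_linear_scaleR_right]) simp
  have sc: "onorm (\<lambda>z. c *\<^sub>R (complex_matrix A *v z)) = c * opnorm (complex_matrix A)"
    if "0 \<le> c" for c and A :: "real^'a^'b"
    using that onorm_scaleR[of "\<lambda>z. complex_matrix A *v z" c] by simp
  show ?thesis
    unfolding eq using onorm_triangle[OF bl bl, of u A v C] assms by (simp add: sc)
qed

text \<open>
  The case \<open>r \<le> 0\<close> is split off because the open ball of radius \<open>r\<close> is then empty and there is
  nothing to separate; \<open>Q = 0\<close> serves. Otherwise the separating matrix \<open>a\<close> satisfies
  \<open>r \<langle>a, A\<rangle> \<le> b \<le> \<langle>a, X\<rangle>\<close> whenever \<open>\<parallel>A\<parallel> \<le> 1\<close>, so \<open>Q = r a / \<langle>a, X\<rangle>\<close> has dual norm at most \<open>1\<close>.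
\<close>
lemma osp_norm_attained_on_trace_norm_ball:
  fixes X :: "real ^ 'n ^ 'n"
  obtains Q :: "real ^ 'n ^ 'n" where "complex_matrix Q \<in> graph_space G"
    "Re (trace (matrix_abs (complex_matrix Q))) \<le> 1" "osp_norm G (complex_matrix X) \<le> X \<bullet> Q"
proof -
  define r where "r = osp_norm G (complex_matrix X)"
  define L where "L = {K :: real ^ 'n ^ 'n. \<forall>i j. (i, j) \<in> G \<union> Id \<longrightarrow> K $ i $ j = 0}"
  have sub: "subspace L" by (auto simp: L_def subspace_def)
  have r_le: "r \<le> opnorm (complex_matrix (X + K))" if "K \<in> L" for K
  proof -
    have "complex_matrix K \<in> graph_space_perp G"
      using that by (simp add: L_def graph_space_perp_iff)
    then have "r \<le> opnorm (complex_matrix X + complex_matrix K)"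
      unfolding r_def osp_norm_def by (intro cINF_lower bdd_below_opnorm)
    moreover have "complex_matrix X + complex_matrix K = complex_matrix (X + K)"
      by (simp add: vec_eq_iff)
    ultimately show ?thesis by simp
  qed
  have zero: "complex_matrix (0 :: real ^ 'n ^ 'n) = 0" by (simp add: vec_eq_iff)
  have "(\<lambda>v. (0 :: complex ^ 'n ^ 'n) *v v) = (\<lambda>v. 0)" by (simp add: fun_eq_iff)
  then have opnorm_0: "opnorm (0 :: complex ^ 'n ^ 'n) = 0" using onorm_zero by metis
  show thesis
  proof (cases "r \<le> 0")
    case True
    obtain W where "W \<bullet> (0 :: real ^ 'n ^ 'n) = Re (trace (matrix_abs (complex_matrix (0 :: real ^ 'n ^ 'n))))"
      using trace_norm_attained by blast
    then show thesis
      using True by (intro that[of 0]) (auto simp: r_def graph_space_iff)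
  next
    case False
    define S where "S = {A :: real ^ 'n ^ 'n. opnorm (complex_matrix A) < r}"
    have "convex S"
    proof (rule convexI)
      fix A C and u v :: real
      assume *: "A \<in> S" "C \<in> S" "0 \<le> u" "0 \<le> v" "u + v = 1"
      have "u * opnorm (complex_matrix A) + v * opnorm (complex_matrix C) < r"
        using * by (intro convex_bound_lt) (auto simp: S_def)
      then show "u *\<^sub>R A + v *\<^sub>R C \<in> S"
        using opnorm_convex_comb[of u v A C] * by (simp add: S_def)
    qed
    moreover have "convex ((+) X ` L)"
      using sub by (simp add: convex_translation subspace_imp_convex)
    moreover have "S \<noteq> {}"
    proof -
      have "0 \<in> S" using False by (simp add: S_def zero opnorm_0)
      then show ?thesis by blast
    qed
    moreover have "(+) X ` L \<noteq> {}" using subspace_0[OF sub] by blast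
    moreover have "S \<inter> (+) X ` L = {}" using r_le by (force simp: S_def)
    ultimately obtain a b where a: "a \<noteq> 0" and aS: "\<And>A. A \<in> S \<Longrightarrow> a \<bullet> A \<le> b"
      and aL: "\<And>K. K \<in> L \<Longrightarrow> b \<le> a \<bullet> (X + K)"
      using separating_hyperplane_sets[of S "(+) X ` L"] by blast
    (* A linear functional bounded below on a subspace vanishes on it. *)
    have aK: "a \<bullet> K = 0" if "K \<in> L" for K
    proof (rule ccontr)
      assume nz: "a \<bullet> K \<noteq> 0"
      have "b \<le> a \<bullet> (X + ((b - 1 - a \<bullet> X) / (a \<bullet> K)) *\<^sub>R K)"
        using sub that by (intro aL) (simp add: subspace_scale)
      then show False using nz by (simp add: inner_add_right)
    qed
    have scaled: "opnorm (complex_matrix (t *\<^sub>R A)) \<le> t * opnorm (complex_matrix A)"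
      if "0 \<le> t" for t and A :: "real ^ 'n ^ 'n"
      using opnorm_convex_comb[of t 0 A A] that by simp
    have b0: "0 \<le> b" using aS[of 0] False by (simp add: S_def zero opnorm_0)
    have dual: "r * (a \<bullet> A) \<le> b" if A: "opnorm (complex_matrix A) \<le> 1" for A
    proof (rule ccontr)
      assume c: "\<not> r * (a \<bullet> A) \<le> b"
      then have pos: "0 < a \<bullet> A" using b0 False by (smt (verit) mult_nonneg_nonpos)
      (* A point strictly between b / (a \<bullet> A) and r: t A is in the open ball, yet a \<bullet> (t A) > b. *)
      define t where "t = (b / (a \<bullet> A) + r) / 2"
      have t: "0 \<le> t" "t < r" using c pos b0 False by (auto simp: t_def field_simps)
      have "opnorm (complex_matrix (t *\<^sub>R A)) \<le> t"
        using scaled[OF t(1), of A] mult_left_mono[OF A t(1)] by simp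
      then have "t * (a \<bullet> A) \<le> b" using aS[of "t *\<^sub>R A"] t(2) by (simp add: S_def)
      then show False using c pos by (simp add: t_def field_simps)
    qed
    have "0 < a \<bullet> X"
    proof -
      (* As a \<noteq> 0, the functional is positive at a multiple of a in the unit ball, which forces b > 0. *)
      define N where "N = opnorm (complex_matrix a) + 1"
      have N: "0 < N" unfolding N_def by (simp add: add_nonneg_pos onorm_pos_le)
      have "opnorm (complex_matrix ((1 / N) *\<^sub>R a)) \<le> 1"
        by (rule order_trans[OF scaled]) (use N in \<open>simp_all add: N_def\<close>)
      from dual[OF this] have "r * (a \<bullet> a) / N \<le> b" by simp
      moreover have "0 < r * (a \<bullet> a) / N" using False N a by simp
      moreover have "b \<le> a \<bullet> X" using aL[OF subspace_0[OF sub]] by simp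
      ultimately show ?thesis by linarith
    qed
    define Q where "Q = (r / (a \<bullet> X)) *\<^sub>R a"
    have "Q $ i $ j = 0" if ij: "(i, j) \<notin> G \<union> Id" for i j
    proof -
      have "axis i (axis j 1) \<in> L" using ij by (auto simp: L_def axis_def)
      from aK[OF this] show ?thesis by (simp add: Q_def inner_axis)
    qed
    then have "complex_matrix Q \<in> graph_space G"
      by (simp add: graph_space_iff)
    moreover have "Re (trace (matrix_abs (complex_matrix Q))) \<le> 1"
    proof -
      obtain W where W: "opnorm (complex_matrix W) \<le> 1"
        "W \<bullet> Q = Re (trace (matrix_abs (complex_matrix Q)))"
        using trace_norm_attained by blast
      have "W \<bullet> Q = r * (a \<bullet> W) / (a \<bullet> X)" by (simp add: Q_def inner_commute)
      also have "\<dots> \<le> 1"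
        using dual[OF W(1)] aL[OF subspace_0[OF sub]] \<open>0 < a \<bullet> X\<close> by simp
      finally show ?thesis using W(2) by simp
    qed
    moreover have "osp_norm G (complex_matrix X) \<le> X \<bullet> Q"
      using \<open>0 < a \<bullet> X\<close> by (simp add: Q_def inner_commute flip: r_def)
    ultimately show thesis by (rule that)
  qed
qed

theorem proposition5p6:
  fixes G :: "('n::finite \<times> 'n) set"
    and X :: "real ^ 'n ^ 'n"
  assumes "sym G" and "irrefl G"
  defines "T \<equiv> {trace (transpose X ** Q) | Q :: real ^ 'n ^ 'n.
                 complex_matrix Q \<in> graph_space G \<and> Re (trace (matrix_abs (complex_matrix Q))) \<le> 1}"
  shows "osp_norm G (complex_matrix X) \<in> T \<and> (\<forall>t\<in>T. t \<le> osp_norm G (complex_matrix X))"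
proof -
  obtain Q :: "real ^ 'n ^ 'n" where Q: "complex_matrix Q \<in> graph_space G"
    "Re (trace (matrix_abs (complex_matrix Q))) \<le> 1" "osp_norm G (complex_matrix X) \<le> X \<bullet> Q"
    using osp_norm_attained_on_trace_norm_ball by blast
  have "osp_norm G (complex_matrix X) = X \<bullet> Q"
    using trace_norm_ball_le_osp_norm[OF Q(1,2), of X] Q(3) by simp
  then show ?thesis
    unfolding T_def trace_transpose_mult_eq_inner
    using Q(1,2) trace_norm_ball_le_osp_norm by blast
qed

end
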